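(* Let $n,K\ge 1$, let $\mathcal{B}=\{B_0,\ldots,B_{K-1}\}$ be a partition of $\mathbb{R}$ into $K$ pairwise disjoint measurable sets whose union is $\mathbb{R}$ (up to measure-zero boundaries), and let $\psi^{(K)}:\mathbb{R}^n\to\mathbb{R}_{\ge 0}^{n\times K}$ be the associated multistate embedding. Then the Tanimoto distance $d_{\mathrm{Tan}}$ is a metric on the image $\psi^{(K)}(\mathbb{R}^n)$, and hence the composed distance $$d_{\mathrm{multi}}(X,Y):=d_{\mathrm{Tan}}\bigl(\psi^{(K)}(X),\psi^{(K)}(Y)\bigr)$$ is a pseudometric on $\mathbb{R}^n$. The associated Tanimoto kernel $$K_{\mathrm{multi}}(X,Y):=J_{\mathrm{Tan}}\bigl(\psi^{(K)}(X),\psi^{(K)}(Y)\bigr)$$ is positive semidefinite on $\mathbb{R}^n$.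
   Context: Multistate embedding: for $X=(x_1,\dots,x_n)\in\mathbb{R}^n$, $[\psi^{(K)}(X)]_{i,k}=|x_i|\cdot\mathbf{1}\{x_i\in B_k\}$ for $i=1,\dots,n$, $k=0,\dots,K-1$. The space $\mathbb{R}_{\ge 0}^{n\times K}$ is identified with $\mathbb{R}_{\ge 0}^{nK}$. Tanimoto similarity and distance: for $U,V\in\mathbb{R}_{\ge 0}^{d}$, $J_{\mathrm{Tan}}(U,V)=\dfrac{\sum_j\min\{U_j,V_j\}}{\sum_j\max\{U_j,V_j\}}$ if $\sum_j\max\{U_j,V_j\}>0$, and $J_{\mathrm{Tan}}(U,V)=1$ if $U=V=0$; $d_{\mathrm{Tan}}(U,V)=1-J_{\mathrm{Tan}}(U,V)$. A kernel $k:\mathcal{X}\times\mathcal{X}\to\mathbb{R}$ is positive semidefinite if it is symmetric and $\sum_{i,j}c_ic_jk(x_i,x_j)\ge 0$ for all finite families $x_i\in\mathcal{X}$, $c_i\in\mathbb{R}$. *)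

theory Defs
  imports "HOL-Analysis.Analysis"
begin

text \<open>
  The dimensions are finite index types: \<open>'n\<close> for the coordinates, \<open>'k\<close> for the states.
  Entry \<open>(i, k)\<close> of the \<open>n \<times> K\<close> array is component \<open>(i, k)\<close> of a vector indexed by \<open>'n \<times> 'k\<close>,
  which is the identification of the arrays with vectors of length \<open>n K\<close>.
\<close>

definition multistate_embedding ::
    "('k::finite \<Rightarrow> real set) \<Rightarrow> real ^ 'n::finite \<Rightarrow> real ^ ('n \<times> 'k)" where
  "multistate_embedding B X = (\<chi> p. case p of (i, k) \<Rightarrow> \<bar>X $ i\<bar> * indicat_real (B k) (X $ i))"

text \<open>
  Empty cells are allowed. Disjointness is exact; only the covering of the line is required up
  to a Lebesgue null set.
\<close>

definition bin_partition :: "('k \<Rightarrow> real set) \<Rightarrow> bool" where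
  "bin_partition B \<longleftrightarrow>
     (\<forall>k. B k \<in> sets lebesgue) \<and> disjoint_family B \<and> - (\<Union>k. B k) \<in> null_sets lebesgue"

text \<open>
  The similarity is meant for nonnegative vectors. For those the second branch is
  exactly the case \<open>U = V = 0\<close>, see \<open>tanimoto_denominator_pos_iff\<close> below.
\<close>

definition tanimoto_sim :: "real ^ 'd::finite \<Rightarrow> real ^ 'd \<Rightarrow> real" where
  "tanimoto_sim U V =
     (if (\<Sum>j\<in>UNIV. max (U $ j) (V $ j)) > 0
      then (\<Sum>j\<in>UNIV. min (U $ j) (V $ j)) / (\<Sum>j\<in>UNIV. max (U $ j) (V $ j))
      else 1)"

definition tanimoto_dist :: "real ^ 'd::finite \<Rightarrow> real ^ 'd \<Rightarrow> real" where
  "tanimoto_dist U V = 1 - tanimoto_sim U V"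

definition multi_dist ::
    "('k::finite \<Rightarrow> real set) \<Rightarrow> real ^ 'n::finite \<Rightarrow> real ^ 'n \<Rightarrow> real" where
  "multi_dist B X Y = tanimoto_dist (multistate_embedding B X) (multistate_embedding B Y)"

definition multi_kernel ::
    "('k::finite \<Rightarrow> real set) \<Rightarrow> real ^ 'n::finite \<Rightarrow> real ^ 'n \<Rightarrow> real" where
  "multi_kernel B X Y = tanimoto_sim (multistate_embedding B X) (multistate_embedding B Y)"

definition pseudometric :: "('a \<Rightarrow> 'a \<Rightarrow> real) \<Rightarrow> bool" where
  "pseudometric d \<longleftrightarrow>
     (\<forall>x y. 0 \<le> d x y) \<and> (\<forall>x. d x x = 0) \<and> (\<forall>x y. d x y = d y x) \<and>
     (\<forall>x y z. d x z \<le> d x y + d y z)"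

definition psd_kernel :: "('a \<Rightarrow> 'a \<Rightarrow> real) \<Rightarrow> bool" where
  "psd_kernel k \<longleftrightarrow>
     (\<forall>x y. k x y = k y x) \<and>
     (\<forall>(m::nat) (x :: nat \<Rightarrow> 'a) (c :: nat \<Rightarrow> real).
        0 \<le> (\<Sum>i<m. \<Sum>j<m. c i * c j * k (x i) (x j)))"

lemma multistate_embedding_nth:
  "multistate_embedding B X $ (i, k) = \<bar>X $ i\<bar> * indicat_real (B k) (X $ i)"
  by (simp add: multistate_embedding_def)

lemma multistate_embedding_nonneg: "0 \<le> multistate_embedding B X $ p"
  by (cases p) (simp add: multistate_embedding_nth)

lemma tanimoto_denominator_pos_iff:
  fixes U V :: "real ^ 'd::finite"
  assumes "\<And>j. 0 \<le> U $ j" "\<And>j. 0 \<le> V $ j"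
  shows "(\<Sum>j\<in>UNIV. max (U $ j) (V $ j)) > 0 \<longleftrightarrow> \<not> (U = 0 \<and> V = 0)"
proof -
  have nn: "0 \<le> max (U $ j) (V $ j)" for j
    using assms(1)[of j] by simp
  have "(\<Sum>j\<in>UNIV. max (U $ j) (V $ j)) = 0 \<longleftrightarrow> (\<forall>j. max (U $ j) (V $ j) = 0)"
    using nn by (subst sum_nonneg_eq_0_iff) auto
  also have "\<dots> \<longleftrightarrow> (\<forall>j. U $ j = 0 \<and> V $ j = 0)"
    using assms by (smt (verit))
  also have "\<dots> \<longleftrightarrow> U = 0 \<and> V = 0"
    by (auto simp: vec_eq_iff)
  finally show ?thesis
    using sum_nonneg[of UNIV "\<lambda>j. max (U $ j) (V $ j)"] nn by fastforce
qed

end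

theory Submission
  imports Defs
begin

text \<open>
  On nonnegative vectors the Tanimoto distance is the Steinhaus transform
  \<open>2 \<delta>(U,V) / (\<delta>(U,0) + \<delta>(V,0) + \<delta>(U,V))\<close> of the \<open>\<ell>\<^sup>1\<close> distance \<open>\<delta>\<close>, and this
  transform preserves the triangle inequality.

  For the kernel put \<open>S = \<Sum> min U V\<close>, \<open>a = \<Sum> U\<close>, \<open>b = \<Sum> V\<close>, so that the similarity is
  \<open>S / (a + b - S)\<close>. The Cayley transform \<open>p(a) = (1 - a) / (1 + a)\<close> satisfies
  \<open>(1 + a) (1 + b) (1 - p(a) p(b)) = 2 (a + b)\<close>. With \<open>W = 2 S / ((1 + a) (1 + b))\<close> and
  \<open>T = W + p(a) p(b)\<close>, the similarity is therefore \<open>W / (1 - T) = W \<Sum>\<^sub>k T\<^sup>k\<close>. Both \<open>W\<close> and \<open>T\<close> are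
  Gram kernels because \<open>min\<close> is one, and Gram kernels are closed under sums and products, so
  the similarity is a limit of positive semidefinite kernels.
\<close>

section \<open>The triangle inequality\<close>

definition l1 :: "real ^ 'd::finite \<Rightarrow> real ^ 'd \<Rightarrow> real" where
  "l1 U V = (\<Sum>j\<in>UNIV. \<bar>U $ j - V $ j\<bar>)"

lemma l1_nonneg: "0 \<le> l1 U V"
  by (simp add: l1_def sum_nonneg)

lemma l1_commute: "l1 U V = l1 V U"
  by (simp add: l1_def abs_minus_commute)

lemma l1_triangle: "l1 U W \<le> l1 U V + l1 V W"
  unfolding l1_def sum.distrib[symmetric] by (intro sum_mono) linarith

lemma l1_eq_0_iff: "l1 U V = 0 \<longleftrightarrow> U = V"
  by (simp add: l1_def sum_nonneg_eq_0_iff vec_eq_iff)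

text \<open>Since x / (s + x) grows with x for s \<ge> 0, \<open>r\<close> may be raised to
  \<open>p + q\<close>. After that, \<open>b \<le> c + q\<close> and \<open>b \<le> a + p\<close>
  say that the common denominator dominates both denominators on the right.\<close>

lemma steinhaus_triangle:
  fixes a b c p q r :: real
  assumes "0 \<le> a" "0 \<le> b" "0 \<le> c" "0 \<le> p" "0 \<le> q" "0 \<le> r"
    and "r \<le> p + q" "b \<le> c + q" "b \<le> a + p"
  shows "r / (a + c + r) \<le> p / (a + b + p) + q / (b + c + q)"
proof (cases "r = 0")
  case True
  then show ?thesis using assms by simp
next
  case False
  with assms have r: "0 < r" by simp
  have "r / (a + c + r) \<le> (p + q) / (a + c + (p + q))"
  proof -
    have "r * (a + c) \<le> (p + q) * (a + c)"
      using assms by (intro mult_right_mono) auto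
    then show ?thesis
      using assms r by (simp add: divide_simps) (simp add: algebra_simps)
  qed
  also have "\<dots> = p / (a + c + (p + q)) + q / (a + c + (p + q))"
    by (simp add: add_divide_distrib)
  also have "\<dots> \<le> p / (a + b + p) + q / (b + c + q)"
  proof (rule add_mono)
    show "p / (a + c + (p + q)) \<le> p / (a + b + p)"
      \<comment> \<open>A denominator can vanish only if \<open>p = 0\<close>, and then both
        quotients are 0.\<close>
      using assms by (cases "p = 0") (auto intro!: divide_left_mono mult_pos_pos)
    show "q / (a + c + (p + q)) \<le> q / (b + c + q)"
      using assms by (cases "q = 0") (auto intro!: divide_left_mono mult_pos_pos)
  qed
  finally show ?thesis .
qed

text \<open>Entrywise 2 max(x, y) = x + y + |x - y|, and x = |x - 0| for x \<ge> 0.\<close>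

lemma sum_max_eq:
  fixes U V :: "real ^ 'd::finite"
  assumes "\<And>j. 0 \<le> U $ j" "\<And>j. 0 \<le> V $ j"
  shows "2 * (\<Sum>j\<in>UNIV. max (U $ j) (V $ j)) = l1 U 0 + l1 V 0 + l1 U V"
  unfolding l1_def sum.distrib[symmetric] sum_distrib_left
  by (rule sum.cong) (use assms in \<open>auto simp: max_def\<close>)

lemma tanimoto_dist_nonneg: "0 \<le> tanimoto_dist U V"
proof -
  have "(\<Sum>j\<in>UNIV. min (U $ j) (V $ j)) \<le> (\<Sum>j\<in>UNIV. max (U $ j) (V $ j))"
    by (rule sum_mono) auto
  then show ?thesis by (simp add: tanimoto_dist_def tanimoto_sim_def)
qed

lemma tanimoto_sim_commute: "tanimoto_sim U V = tanimoto_sim V U"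
  by (simp add: tanimoto_sim_def min.commute max.commute)

text \<open>For \<open>U = V = 0\<close> the right-hand side is \<open>0 / 0 = 0\<close>, as it should be.\<close>

lemma tanimoto_dist_eq_steinhaus:
  fixes U V :: "real ^ 'd::finite"
  assumes "\<And>j. 0 \<le> U $ j" "\<And>j. 0 \<le> V $ j"
  shows "tanimoto_dist U V = 2 * (l1 U V / (l1 U 0 + l1 V 0 + l1 U V))"
proof -
  define M where "M = (\<Sum>j\<in>UNIV. max (U $ j) (V $ j))"
  define m where "m = (\<Sum>j\<in>UNIV. min (U $ j) (V $ j))"
  have M2: "2 * M = l1 U 0 + l1 V 0 + l1 U V"
    using sum_max_eq[OF assms] by (simp add: M_def)
  have diff: "M - m = l1 U V"
    unfolding M_def m_def l1_def sum_subtractf[symmetric] by (rule sum.cong) auto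
  have M0: "0 \<le> M" using M2 l1_nonneg[of U 0] l1_nonneg[of V 0] l1_nonneg[of U V] by linarith
  show ?thesis
  proof (cases "M = 0")
    case True
    then show ?thesis using M2
      by (simp add: tanimoto_dist_def tanimoto_sim_def M_def)
  next
    case False
    then show ?thesis using M0 diff
      by (simp add: tanimoto_dist_def tanimoto_sim_def M2[symmetric] flip: M_def m_def)
        (simp add: field_simps)
  qed
qed

lemma tanimoto_dist_triangle:
  fixes U V W :: "real ^ 'd::finite"
  assumes "\<And>j. 0 \<le> U $ j" "\<And>j. 0 \<le> V $ j" "\<And>j. 0 \<le> W $ j"
  shows "tanimoto_dist U W \<le> tanimoto_dist U V + tanimoto_dist V W"
proof -
  have "l1 U W / (l1 U 0 + l1 W 0 + l1 U W)
      \<le> l1 U V / (l1 U 0 + l1 V 0 + l1 U V) + l1 V W / (l1 V 0 + l1 W 0 + l1 V W)"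
    using l1_triangle[of V 0 W] l1_triangle[of V 0 U]
    by (intro steinhaus_triangle l1_nonneg l1_triangle) (auto simp: l1_commute)
  then show ?thesis using assms by (simp add: tanimoto_dist_eq_steinhaus)
qed

lemma tanimoto_dist_eq_0_iff:
  fixes U V :: "real ^ 'd::finite"
  assumes "\<And>j. 0 \<le> U $ j" "\<And>j. 0 \<le> V $ j"
  shows "tanimoto_dist U V = 0 \<longleftrightarrow> U = V"
  using l1_nonneg[of U 0] l1_nonneg[of V 0] l1_nonneg[of U V] l1_eq_0_iff[of U V] assms
  by (auto simp: tanimoto_dist_eq_steinhaus add_nonneg_eq_0_iff)

section \<open>Gram kernels\<close>

text \<open>A finite nonnegative combination of rank-one kernels, with equality demanded on
  \<open>I\<close> only. Building it one term at a time turns the closure properties into inductions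
  on the number of terms.\<close>

inductive gram :: "'a set \<Rightarrow> ('a \<Rightarrow> 'a \<Rightarrow> real) \<Rightarrow> bool" for I where
  zero: "(\<And>i j. i \<in> I \<Longrightarrow> j \<in> I \<Longrightarrow> k i j = 0) \<Longrightarrow> gram I k"
| add_rank1: "gram I k' \<Longrightarrow> 0 \<le> c \<Longrightarrow>
    (\<And>i j. i \<in> I \<Longrightarrow> j \<in> I \<Longrightarrow> k i j = k' i j + c * f i * f j) \<Longrightarrow> gram I k"

lemma gram_cong:
  assumes "gram I k" "\<And>i j. i \<in> I \<Longrightarrow> j \<in> I \<Longrightarrow> k i j = k' i j"
  shows "gram I k'"
  \<comment> \<open>A term with coefficient 0 is added just to change the kernel off
    \<open>I\<close>.\<close>
  by (rule gram.add_rank1[OF assms(1), where c = 0]) (use assms(2) in auto)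

lemma gram_rank1:
  assumes "0 \<le> c"
  shows "gram I (\<lambda>i j. c * f i * f j)"
  by (rule gram.add_rank1[OF gram.zero[of I "\<lambda>_ _. 0"] assms]) auto

lemma gram_add:
  assumes "gram I k" "gram I l"
  shows "gram I (\<lambda>i j. k i j + l i j)"
  using assms
proof induction
  case (zero k)
  then show ?case by (auto intro: gram_cong)
next
  case (add_rank1 k' c k f)
  from add_rank1.IH[OF add_rank1.prems] add_rank1.hyps(2) show ?case
    by (rule gram.add_rank1) (use add_rank1.hyps(3) in auto)
qed

lemma gram_mult_rank1:
  assumes "gram I k" "0 \<le> c"
  shows "gram I (\<lambda>i j. c * f i * f j * k i j)"
  using assms(1)
proof induction
  case (zero k)
  then show ?case by (auto intro: gram.zero)
next
  case (add_rank1 k' d k g)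
  show ?case
    by (rule gram.add_rank1[OF add_rank1.IH, where c = "c * d" and f = "\<lambda>i. f i * g i"])
      (use add_rank1.hyps assms(2) in \<open>auto simp: algebra_simps\<close>)
qed

text \<open>Schur product: expand the first factor into rank-one terms. Each of them times
  \<open>l\<close> is Gram by \<open>gram_mult_rank1\<close>.\<close>

lemma gram_mult:
  assumes "gram I k" "gram I l"
  shows "gram I (\<lambda>i j. k i j * l i j)"
  using assms(1)
proof induction
  case (zero k)
  then show ?case by (auto intro: gram.zero)
next
  case (add_rank1 k' c k f)
  show ?case
    by (rule gram_cong[OF gram_add[OF add_rank1.IH
          gram_mult_rank1[OF assms(2) add_rank1.hyps(2), of f]]])
      (use add_rank1.hyps(3) in \<open>auto simp: algebra_simps\<close>)
qed

lemma gram_power: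
  assumes "gram I k"
  shows "gram I (\<lambda>i j. k i j ^ n)"
proof (induction n)
  case 0
  show ?case using gram_rank1[of 1 I "\<lambda>_. 1"] by simp
next
  case (Suc n)
  then show ?case using gram_mult[OF assms] by simp
qed

lemma gram_sum:
  assumes "finite A" "\<And>r. r \<in> A \<Longrightarrow> gram I (k r)"
  shows "gram I (\<lambda>i j. \<Sum>r\<in>A. k r i j)"
  using assms by (induction A) (auto intro: gram.zero gram_add)

text \<open>
  Splitting off the smallest nonzero value of \<open>u\<close> leaves a \<open>min\<close> kernel with smaller support.
\<close>

lemma gram_min:
  fixes u :: "'a \<Rightarrow> real"
  assumes "finite I" "\<And>i. i \<in> I \<Longrightarrow> 0 \<le> u i"
  shows "gram I (\<lambda>i j. min (u i) (u j))"
  using assms(2)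
proof (induction "card {i \<in> I. u i \<noteq> 0}" arbitrary: u rule: less_induct)
  case less
  define P where "P = {i \<in> I. u i \<noteq> 0}"
  have fin: "finite P" using assms(1) by (simp add: P_def)
  show ?case
  proof (cases "P = {}")
    case True
    then have "u i = 0" if "i \<in> I" for i using that by (auto simp: P_def)
    then show ?thesis by (auto intro: gram.zero)
  next
    case False
    define t where "t = Min (u ` P)"
    have "t \<in> u ` P" using False fin by (simp add: t_def)
    then obtain i0 where i0: "i0 \<in> P" "u i0 = t" by auto
    have tle: "t \<le> u i" if "i \<in> P" for i using that fin by (simp add: t_def)
    have t0: "0 \<le> t" using i0 less.prems by (auto simp: P_def)
    \<comment> \<open>\<open>v\<close> vanishes at the minimiser \<open>i0\<close> and wherever
      \<open>u\<close> does, so its support is strictly smaller.\<close>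
    define v where "v = (\<lambda>i. u i - t * indicat_real P i)"
    have u0: "u i = 0" if "i \<in> I" "i \<notin> P" for i using that by (auto simp: P_def)
    have "{i \<in> I. v i \<noteq> 0} \<subseteq> P - {i0}" using i0 u0 by (auto simp: v_def indicator_def)
    then have "card {i \<in> I. v i \<noteq> 0} < card P"
      using fin i0 by (intro psubset_card_mono) auto
    moreover have "0 \<le> v i" if "i \<in> I" for i
      using tle[of i] u0[of i] that by (cases "i \<in> P") (auto simp: v_def)
    ultimately have "gram I (\<lambda>i j. min (v i) (v j))"
      by (intro less.hyps) (auto simp: P_def)
    from this t0 show ?thesis
    proof (rule gram.add_rank1[where f = "indicat_real P"])
      \<comment> \<open>Inside \<open>P\<close> both arguments of the minimum drop by
        \<open>t\<close>; if an index lies outside \<open>P\<close>, both minima are 0.\<close>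
      fix i j assume "i \<in> I" "j \<in> I"
      then show "min (u i) (u j)
          = min (v i) (v j) + t * indicat_real P i * indicat_real P j"
        using tle[of i] tle[of j] u0[of i] u0[of j] t0
        by (cases "i \<in> P"; cases "j \<in> P") (auto simp: v_def)
    qed
  qed
qed

text \<open>Each rank-one term contributes a nonnegative multiple of the square of \<Sum>
  \<open>c i * f i\<close>.\<close>

lemma gram_nonneg:
  assumes "gram I k"
  shows "0 \<le> (\<Sum>i\<in>I. \<Sum>j\<in>I. c i * c j * k i j)"
  using assms
proof induction
  case (zero k)
  then show ?case by simp
next
  case (add_rank1 k' d k f)
  have "(\<Sum>i\<in>I. \<Sum>j\<in>I. c i * c j * k i j)
      = (\<Sum>i\<in>I. \<Sum>j\<in>I. c i * c j * k' i j + d * ((c i * f i) * (c j * f j)))"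
    by (intro sum.cong refl) (simp add: add_rank1.hyps(3) algebra_simps)
  also have "\<dots> = (\<Sum>i\<in>I. \<Sum>j\<in>I. c i * c j * k' i j) + d * (\<Sum>i\<in>I. c i * f i)\<^sup>2"
    by (simp add: sum.distrib sum_product power2_eq_square) (simp only: sum_distrib_left)
  finally show ?case using add_rank1 by simp
qed

section \<open>The Tanimoto kernel\<close>

text \<open>The \<open>of_bool\<close> product, itself of rank one, supplies the value 1 at
  \<open>U = V = 0\<close>, where \<open>W = 0\<close> and the geometric series has ratio 1.
  Otherwise it is 0 and the ratio lies strictly between -1 and 1.\<close>

lemma tanimoto_sim_tendsto:
  fixes U V :: "real ^ 'd::finite"
  defines "S \<equiv> (\<Sum>j\<in>UNIV. min (U $ j) (V $ j))"
    and "a \<equiv> (\<Sum>j\<in>UNIV. U $ j)" and "b \<equiv> (\<Sum>j\<in>UNIV. V $ j)"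
  defines "W \<equiv> 2 * S / ((1 + a) * (1 + b))"
  assumes "\<And>j. 0 \<le> U $ j" "\<And>j. 0 \<le> V $ j"
  shows "(\<lambda>N. of_bool (U = 0) * of_bool (V = 0)
            + W * (\<Sum>r<N. (W + (1 - a) / (1 + a) * ((1 - b) / (1 + b))) ^ r))
         \<longlonglongrightarrow> tanimoto_sim U V"
proof (cases "U = 0 \<and> V = 0")
  case True
  then show ?thesis by (simp add: tanimoto_sim_def W_def S_def)
next
  case False
  define M where "M = (\<Sum>j\<in>UNIV. max (U $ j) (V $ j))"
  define T where "T = W + (1 - a) / (1 + a) * ((1 - b) / (1 + b))"
  have M: "0 < M"
    using False tanimoto_denominator_pos_iff[of U V] assms(5,6) by (simp add: M_def)
  have MS: "M = a + b - S"
    unfolding M_def S_def a_def b_def sum.distrib[symmetric] sum_subtractf[symmetric]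
    by (rule sum.cong) auto
  have S0: "0 \<le> S" unfolding S_def using assms(5,6) by (intro sum_nonneg) auto
  have a0: "0 \<le> a" unfolding a_def using assms(5) by (intro sum_nonneg) auto
  have b0: "0 \<le> b" unfolding b_def using assms(6) by (intro sum_nonneg) auto
  have one_minus_T: "1 - T = 2 * M / ((1 + a) * (1 + b))"
    using a0 b0 by (simp add: T_def W_def MS divide_simps) (simp add: algebra_simps)
  have "0 < 1 - T" unfolding one_minus_T using a0 b0 M by simp
  moreover have "0 < 1 + T"
  proof -
    \<comment> \<open>Here (1 + a)(1 + b) + (1 - a)(1 - b) = 2 + 2ab.\<close>
    have "1 + T = (2 + 2 * (a * b) + 2 * S) / ((1 + a) * (1 + b))"
      using a0 b0 by (simp add: T_def W_def divide_simps) (simp add: algebra_simps)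
    also have "\<dots> > 0" using a0 b0 S0 by (intro divide_pos_pos add_pos_nonneg) auto
    finally show ?thesis .
  qed
  ultimately have "(\<lambda>r. T ^ r) sums (1 / (1 - T))" by (intro geometric_sums) auto
  then have "(\<lambda>N. W * (\<Sum>r<N. T ^ r)) \<longlonglongrightarrow> W * (1 / (1 - T))"
    unfolding sums_def by (rule tendsto_mult_left)
  moreover have "W * (1 / (1 - T)) = tanimoto_sim U V"
    unfolding one_minus_T using a0 b0 M
    by (simp add: W_def tanimoto_sim_def divide_simps flip: M_def S_def)
  moreover have "of_bool (U = 0) * of_bool (V = 0) = (0::real)" using False by auto
  ultimately show ?thesis by (simp only: T_def add_0)
qed

text \<open>For fixed \<open>c\<close> the quadratic form of each Gram approximant
  \<open>J N\<close> is nonnegative, and this survives the limit since the double sum is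
  finite.\<close>

lemma tanimoto_sim_psd:
  fixes U :: "'a \<Rightarrow> real ^ 'd::finite"
  assumes "finite I" and nn: "\<And>i j. 0 \<le> U i $ j"
  shows "0 \<le> (\<Sum>i\<in>I. \<Sum>j\<in>I. c i * c j * tanimoto_sim (U i) (U j))"
proof -
  define a where "a = (\<lambda>i. \<Sum>q\<in>UNIV. U i $ q)"
  define S where "S = (\<lambda>i j. \<Sum>q\<in>UNIV. min (U i $ q) (U j $ q))"
  define W where "W = (\<lambda>i j. 2 * S i j / ((1 + a i) * (1 + a j)))"
  define T where "T = (\<lambda>i j. W i j + (1 - a i) / (1 + a i) * ((1 - a j) / (1 + a j)))"
  define J where "J = (\<lambda>N i j. of_bool (U i = 0) * of_bool (U j = 0)
      + W i j * (\<Sum>r<N. T i j ^ r))"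
  have gS: "gram I S"
    unfolding S_def using assms by (intro gram_sum gram_min) auto
  have gW: "gram I W"
    by (rule gram_cong[OF gram_mult_rank1[OF gS, of 2 "\<lambda>i. 1 / (1 + a i)"]])
      (auto simp: W_def)
  have gT: "gram I T"
    unfolding T_def
    using gram_add[OF gW gram_rank1[of 1 I "\<lambda>i. (1 - a i) / (1 + a i)"]] by simp
  have gJ: "gram I (J N)" for N
    unfolding J_def
    using gram_add[OF gram_rank1[of 1 I "\<lambda>i. of_bool (U i = 0)"]
        gram_mult[OF gW gram_sum[OF finite_lessThan gram_power[OF gT]]]] by simp
  have "(\<lambda>N. J N i j) \<longlonglongrightarrow> tanimoto_sim (U i) (U j)" for i j
    using tanimoto_sim_tendsto[of "U i" "U j"] nn
    by (simp add: J_def T_def W_def S_def a_def)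
  then have "(\<lambda>N. \<Sum>i\<in>I. \<Sum>j\<in>I. c i * c j * J N i j)
      \<longlonglongrightarrow> (\<Sum>i\<in>I. \<Sum>j\<in>I. c i * c j * tanimoto_sim (U i) (U j))"
    by (intro tendsto_intros)
  then show ?thesis
    by (rule LIMSEQ_le_const) (use gram_nonneg[OF gJ] in auto)
qed

theorem theorem3p22:
  fixes B :: "'k::finite \<Rightarrow> real set"
  assumes "bin_partition B"
  shows "Metric_space (range (multistate_embedding B :: real ^ 'n::finite \<Rightarrow> real ^ ('n \<times> 'k)))
           tanimoto_dist
       \<and> pseudometric (multi_dist B :: real ^ 'n \<Rightarrow> real ^ 'n \<Rightarrow> real)
       \<and> psd_kernel (multi_kernel B :: real ^ 'n \<Rightarrow> real ^ 'n \<Rightarrow> real)"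
proof (intro conjI)
  note nn = multistate_embedding_nonneg
  have commute: "tanimoto_dist U V = tanimoto_dist V U" for U V :: "real ^ ('n \<times> 'k)"
    by (simp add: tanimoto_dist_def tanimoto_sim_commute)
  show "Metric_space (range (multistate_embedding B :: real ^ 'n \<Rightarrow> real ^ ('n \<times> 'k)))
          tanimoto_dist"
    by unfold_locales
      (auto intro: tanimoto_dist_nonneg commute tanimoto_dist_triangle nn
        simp: tanimoto_dist_eq_0_iff nn)
  \<comment> \<open>The embedding may identify points, such as x and -x in a common cell, so
    separation need not carry over from the image.\<close>
  show "pseudometric (multi_dist B :: real ^ 'n \<Rightarrow> real ^ 'n \<Rightarrow> real)"
    unfolding pseudometric_def multi_dist_def
    by (auto intro: tanimoto_dist_nonneg commute tanimoto_dist_triangle nn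
        simp: tanimoto_dist_eq_0_iff nn)
  show "psd_kernel (multi_kernel B :: real ^ 'n \<Rightarrow> real ^ 'n \<Rightarrow> real)"
    unfolding psd_kernel_def multi_kernel_def
    by (auto intro: tanimoto_sim_commute tanimoto_sim_psd nn)
qed

end
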